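(* Let $K$ be an infinite field of characteristic different from $2$ and $3$, and let $(A,\omega)$ be a Bernstein algebra over $K$ with barideal $N=\ker(\omega)$. Then $A$ is Noetherian if and only if $N$ (regarded as an algebra in its own right) is Noetherian. Likewise, $A$ is Artinian if and only if $N$ is Artinian.
   Context: Algebras over $K$ are not assumed associative, unital or finite-dimensional. A baric algebra over $K$ is a pair $(A,\omega)$ where $A$ is a $K$-algebra and $\omega:A\to K$ is a nonzero homomorphism of $K$-algebras; its barideal is $\ker(\omega)$, which is an ideal of $A$. A Bernstein algebra is a commutative baric algebra $(A,\omega)$ satisfying $(x^2)^2=\omega(x)^2x^2$ for all $x\in A$. An algebra is Noetherian (Artinian) if every ascending (descending) sequence of its ideals is stationary; for $N$ this refers to ideals of the algebra $N$, not to ideals of $A$ contained in $N$. *)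

theory Defs
  imports Complex_Main
begin

text \<open>The algebra \<open>A\<close> is a whole type. Ideals and chain conditions are relative to a subset
  \<open>S\<close> (in practice a subalgebra) and only involve products with elements of \<open>S\<close>; so \<open>S = UNIV\<close>
  gives the notions for \<open>A\<close>, and a smaller \<open>S\<close> those for \<open>S\<close> as an algebra in its own right.\<close>

locale nonassoc_algebra = vector_space scale
  for scale :: "'k::field \<Rightarrow> 'a::ab_group_add \<Rightarrow> 'a" (infixr "*s" 75) +
  fixes mult :: "'a \<Rightarrow> 'a \<Rightarrow> 'a" (infixl "\<cdot>" 70)
  assumes linear_mult_right: "\<And>x. Vector_Spaces.linear scale scale (\<lambda>y. x \<cdot> y)"
    and linear_mult_left: "\<And>y. Vector_Spaces.linear scale scale (\<lambda>x. x \<cdot> y)"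
begin

definition subalgebra :: "'a set \<Rightarrow> bool" where
  "subalgebra S \<longleftrightarrow> subspace S \<and> (\<forall>x\<in>S. \<forall>y\<in>S. x \<cdot> y \<in> S)"

definition ideal_of :: "'a set \<Rightarrow> 'a set \<Rightarrow> bool" where
  "ideal_of S I \<longleftrightarrow> I \<subseteq> S \<and> subspace I \<and> (\<forall>x\<in>S. \<forall>y\<in>I. x \<cdot> y \<in> I \<and> y \<cdot> x \<in> I)"

definition noetherian :: "'a set \<Rightarrow> bool" where
  "noetherian S \<longleftrightarrow>
    (\<forall>I :: nat \<Rightarrow> 'a set. (\<forall>n. ideal_of S (I n)) \<and> incseq I \<longrightarrow> (\<exists>m. \<forall>n\<ge>m. I n = I m))"

definition artinian :: "'a set \<Rightarrow> bool" where
  "artinian S \<longleftrightarrow>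
    (\<forall>I :: nat \<Rightarrow> 'a set. (\<forall>n. ideal_of S (I n)) \<and> decseq I \<longrightarrow> (\<exists>m. \<forall>n\<ge>m. I n = I m))"

end

locale baric_algebra = nonassoc_algebra scale mult
  for scale :: "'k::field \<Rightarrow> 'a::ab_group_add \<Rightarrow> 'a" (infixr "*s" 75)
    and mult :: "'a \<Rightarrow> 'a \<Rightarrow> 'a" (infixl "\<cdot>" 70) +
  fixes \<omega> :: "'a \<Rightarrow> 'k"
  assumes weight_linear: "Vector_Spaces.linear scale (*) \<omega>"
    and weight_mult: "\<And>x y. \<omega> (x \<cdot> y) = \<omega> x * \<omega> y"
    and weight_nonzero: "\<exists>x. \<omega> x \<noteq> 0"

definition barideal :: "('a \<Rightarrow> 'k::zero) \<Rightarrow> 'a set" where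
  "barideal \<omega> = {x. \<omega> x = 0}"

locale bernstein_algebra = baric_algebra scale mult \<omega>
  for scale :: "'k::field \<Rightarrow> 'a::ab_group_add \<Rightarrow> 'a" (infixr "*s" 75)
    and mult :: "'a \<Rightarrow> 'a \<Rightarrow> 'a" (infixl "\<cdot>" 70)
    and \<omega> :: "'a \<Rightarrow> 'k" +
  assumes mult_commute: "\<And>x y. x \<cdot> y = y \<cdot> x"
    and bernstein: "\<And>x. (x \<cdot> x) \<cdot> (x \<cdot> x) = (\<omega> x)\<^sup>2 *s (x \<cdot> x)"

context baric_algebra
begin

lemma ideal_of_barideal: "ideal_of UNIV (barideal \<omega>)"
proof -
  interpret w: Vector_Spaces.linear scale "(*)" \<omega> by (rule weight_linear)
  show ?thesis
    by (auto simp: ideal_of_def barideal_def subspace_def weight_mult w.add w.scale w.zero)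
qed

lemma subalgebra_barideal: "subalgebra (barideal \<omega>)"
  using ideal_of_barideal by (auto simp: ideal_of_def subalgebra_def)

end

end

theory Submission
  imports Defs "HOL-Computational_Algebra.Primes"
begin

text \<open>
  Let \<open>N\<close> be the barideal. If \<open>N\<close> satisfies a chain condition, so does \<open>A\<close>: an ideal \<open>I\<close> of \<open>A\<close>
  meets \<open>N\<close> in an ideal of \<open>N\<close> of codimension at most one in \<open>I\<close>, so along a chain of ideals \<open>I\<close> is
  determined by \<open>I \<inter> N\<close> and by whether \<open>I \<subseteq> N\<close>.

  For the converse, an ideal \<open>I\<close> of \<open>N\<close> need not be an ideal of \<open>A\<close>, since it need not be stable
  under multiplication by an idempotent \<open>e\<close> of weight one. The Bernstein identity gives the Peirce
  decomposition \<open>N = U \<oplus> V\<close>, where \<open>e\<close> acts as \<open>1/2\<close> on \<open>U\<close> and as \<open>0\<close> on \<open>V\<close>, together with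
  \<open>UU \<subseteq> V\<close>, \<open>UV \<subseteq> U\<close>, \<open>VV \<subseteq> U\<close> and the skew-symmetry \<open>u'(uv) = -u(u'v)\<close>. Two ideals of \<open>A\<close> are
  attached to \<open>I\<close>, both monotone in \<open>I\<close>:

  \<^item> the core \<open>(I \<inter> U) \<oplus> (I \<inter> V)\<close>, contained in \<open>I\<close> (\<open>ideal_of_core\<close>);

  \<^item> the envelope \<open>T \<oplus> P\<close>, containing \<open>I\<close>, where \<open>P\<close> is the projection of \<open>I\<close> to \<open>V\<close> and \<open>T\<close>
    consists of those \<open>u \<in> U\<close> with \<open>U u \<subseteq> P\<close> (\<open>ideal_of_envelope\<close>).

  The core knows \<open>I \<inter> U\<close> and the envelope knows the projection of \<open>I\<close> to \<open>V\<close>. These are the kernel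
  and the image of \<open>I \<rightarrow> V\<close>, so comparable ideals with the same core and envelope coincide
  (\<open>ideal_eqI_core_envelope\<close>). A chain of ideals of \<open>N\<close> is therefore stationary once the two
  associated chains of ideals of \<open>A\<close> are.
\<close>

section \<open>Stationary sequences\<close>

definition stationary :: "(nat \<Rightarrow> 'b) \<Rightarrow> bool" where
  "stationary X \<longleftrightarrow> (\<exists>m. \<forall>n\<ge>m. X n = X m)"

lemma stationary_monotone_bool:
  fixes P :: "nat \<Rightarrow> bool"
  assumes "(\<forall>m n. m \<le> n \<longrightarrow> P m \<longrightarrow> P n) \<or> (\<forall>m n. m \<le> n \<longrightarrow> P n \<longrightarrow> P m)"
  shows "stationary P"
  using assms unfolding stationary_def by (metis order_refl le0)

text \<open>Any two terms of a monotone sequence are comparable, so the pair \<open>(f, g)\<close> has to separate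
  comparable elements only. This weak form of injectivity is what the invariants of ideals used
  below provide.\<close>

lemma stationary_if_invariants_stationary:
  fixes X :: "nat \<Rightarrow> 'b::order"
  assumes X: "incseq X \<or> decseq X"
    and f: "stationary (\<lambda>n. f (X n))" and g: "stationary (\<lambda>n. g (X n))"
    and determined:
      "\<And>m n. X m \<le> X n \<Longrightarrow> f (X m) = f (X n) \<Longrightarrow> g (X m) = g (X n) \<Longrightarrow> X m = X n"
  shows "stationary X"
proof -
  obtain k l where k: "\<And>n. n \<ge> k \<Longrightarrow> f (X n) = f (X k)" and l: "\<And>n. n \<ge> l \<Longrightarrow> g (X n) = g (X l)"
    using f g by (auto simp: stationary_def)
  have "X n = X (max k l)" if n: "n \<ge> max k l" for n
  proof -
    have "X (max k l) \<le> X n \<or> X n \<le> X (max k l)"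
      using X incseqD[of X "max k l" n] decseqD[of X "max k l" n] n by blast
    moreover have "f (X n) = f (X (max k l))" "g (X n) = g (X (max k l))"
      using k[of n] k[of "max k l"] l[of n] l[of "max k l"] n by auto
    ultimately show ?thesis
      using determined[of n "max k l"] determined[of "max k l" n] by auto
  qed
  then show ?thesis unfolding stationary_def by blast
qed

section \<open>Bilinearity, ideals and chain conditions\<close>

context nonassoc_algebra
begin

lemma mult_add_right: "x \<cdot> (y + z) = x \<cdot> y + x \<cdot> z"
  and mult_scale_right: "x \<cdot> (c *s y) = c *s (x \<cdot> y)"
  and mult_zero_right: "x \<cdot> 0 = 0"
  and mult_minus_right: "x \<cdot> (- y) = - (x \<cdot> y)"
  and mult_diff_right: "x \<cdot> (y - z) = x \<cdot> y - x \<cdot> z"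
proof -
  interpret r: Vector_Spaces.linear scale scale "\<lambda>y. x \<cdot> y" by (rule linear_mult_right)
  show "x \<cdot> (y + z) = x \<cdot> y + x \<cdot> z" "x \<cdot> (c *s y) = c *s (x \<cdot> y)" "x \<cdot> 0 = 0"
    "x \<cdot> (- y) = - (x \<cdot> y)" "x \<cdot> (y - z) = x \<cdot> y - x \<cdot> z"
    by (rule r.add r.scale r.zero r.neg r.diff)+
qed

lemma mult_add_left: "(y + z) \<cdot> x = y \<cdot> x + z \<cdot> x"
  and mult_scale_left: "(c *s y) \<cdot> x = c *s (y \<cdot> x)"
  and mult_zero_left: "0 \<cdot> x = 0"
  and mult_minus_left: "(- y) \<cdot> x = - (y \<cdot> x)"
  and mult_diff_left: "(y - z) \<cdot> x = y \<cdot> x - z \<cdot> x"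
proof -
  interpret l: Vector_Spaces.linear scale scale "\<lambda>y. y \<cdot> x" by (rule linear_mult_left)
  show "(y + z) \<cdot> x = y \<cdot> x + z \<cdot> x" "(c *s y) \<cdot> x = c *s (y \<cdot> x)" "0 \<cdot> x = 0"
    "(- y) \<cdot> x = - (y \<cdot> x)" "(y - z) \<cdot> x = y \<cdot> x - z \<cdot> x"
    by (rule l.add l.scale l.zero l.neg l.diff)+
qed

lemmas bilinear_simps =
  mult_add_right mult_scale_right mult_zero_right mult_minus_right mult_diff_right
  mult_add_left mult_scale_left mult_zero_left mult_minus_left mult_diff_left

lemma scale_two: "2 *s x = x + x"
  using scale_left_distrib[of 1 1 x] by simp

lemma ideal_of_subspace: "ideal_of S I \<Longrightarrow> subspace I"
  by (simp add: ideal_of_def)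

lemma noetherian_iff_stationary:
  "noetherian S \<longleftrightarrow> (\<forall>I. (\<forall>n. ideal_of S (I n)) \<and> incseq I \<longrightarrow> stationary I)"
  by (simp add: noetherian_def stationary_def)

lemma artinian_iff_stationary:
  "artinian S \<longleftrightarrow> (\<forall>I. (\<forall>n. ideal_of S (I n)) \<and> decseq I \<longrightarrow> stationary I)"
  by (simp add: artinian_def stationary_def)

lemma noetherian_image:
  assumes "noetherian T" and "\<And>I. ideal_of S I \<Longrightarrow> ideal_of T (f I)" and "mono f"
    and "\<And>n. ideal_of S (X n)" and "incseq X"
  shows "stationary (\<lambda>n. f (X n))"
  using assms(1)[unfolded noetherian_iff_stationary, rule_format, of "\<lambda>n. f (X n)"] assms(2-)
  by (auto simp: monotone_def)

lemma artinian_image: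
  assumes "artinian T" and "\<And>I. ideal_of S I \<Longrightarrow> ideal_of T (f I)" and "mono f"
    and "\<And>n. ideal_of S (X n)" and "decseq X"
  shows "stationary (\<lambda>n. f (X n))"
  using assms(1)[unfolded artinian_iff_stationary, rule_format, of "\<lambda>n. f (X n)"] assms(2-)
  by (auto simp: monotone_def)

end

section \<open>From the barideal to the algebra\<close>

context baric_algebra
begin

lemma weight_add: "\<omega> (x + y) = \<omega> x + \<omega> y"
  and weight_scale: "\<omega> (c *s x) = c * \<omega> x"
  and weight_zero: "\<omega> 0 = 0"
  and weight_diff: "\<omega> (x - y) = \<omega> x - \<omega> y"
proof -
  interpret w: Vector_Spaces.linear scale "(*)" \<omega> by (rule weight_linear)
  show "\<omega> (x + y) = \<omega> x + \<omega> y" "\<omega> (c *s x) = c * \<omega> x" "\<omega> 0 = 0" "\<omega> (x - y) = \<omega> x - \<omega> y"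
    by (rule w.add w.scale w.zero w.diff)+
qed

lemmas weight_simps = weight_add weight_scale weight_zero weight_diff weight_mult

lemma subspace_barideal: "subspace (barideal \<omega>)"
  using subalgebra_barideal by (simp add: subalgebra_def)

lemma ideal_of_Int_barideal:
  assumes "ideal_of UNIV I"
  shows "ideal_of (barideal \<omega>) (I \<inter> barideal \<omega>)"
  using assms ideal_of_barideal subspace_barideal
  by (auto simp: ideal_of_def subspace_inter)

lemma mono_Int_barideal: "mono (\<lambda>I. I \<inter> barideal \<omega>)"
  by (auto simp: monotone_def)

text \<open>The barideal is a hyperplane, so a subspace outside it is spanned by its intersection with the
  barideal and any one of its elements of nonzero weight.\<close>

lemma subspace_eqI_barideal:
  assumes "subspace I" and "subspace J" and "I \<subseteq> J"
    and N: "I \<inter> barideal \<omega> = J \<inter> barideal \<omega>" and deg: "I \<subseteq> barideal \<omega> \<longleftrightarrow> J \<subseteq> barideal \<omega>"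
  shows "I = J"
proof (cases "J \<subseteq> barideal \<omega>")
  case True
  then show ?thesis using N \<open>I \<subseteq> J\<close> by blast
next
  case False
  then obtain x where x: "x \<in> I" "\<omega> x \<noteq> 0" using deg by (auto simp: barideal_def)
  have "y \<in> I" if y: "y \<in> J" for y
  proof -
    let ?c = "\<omega> y / \<omega> x"
    have "y - ?c *s x \<in> J \<inter> barideal \<omega>"
      using x y \<open>I \<subseteq> J\<close> \<open>subspace J\<close>
      by (auto simp: barideal_def weight_simps intro!: subspace_diff subspace_scale)
    then have "(y - ?c *s x) + ?c *s x \<in> I"
      using N x \<open>subspace I\<close> by (intro subspace_add subspace_scale) auto
    then show ?thesis by simp
  qed
  with \<open>I \<subseteq> J\<close> show ?thesis by blast
qed

lemma stationary_if_Int_barideal_stationary: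
  assumes X: "\<And>n. ideal_of UNIV (X n)" "incseq X \<or> decseq X"
    and st: "stationary (\<lambda>n. X n \<inter> barideal \<omega>)"
  shows "stationary X"
proof (rule stationary_if_invariants_stationary[OF X(2) st])
  show "stationary (\<lambda>n. X n \<subseteq> barideal \<omega>)"
    using X(2) by (intro stationary_monotone_bool) (auto dest: incseqD decseqD)
qed (rule subspace_eqI_barideal[OF ideal_of_subspace[OF X(1)] ideal_of_subspace[OF X(1)]])

lemma noetherian_if_barideal_noetherian:
  assumes "noetherian (barideal \<omega>)"
  shows "noetherian UNIV"
  unfolding noetherian_iff_stationary
proof (intro allI impI, elim conjE)
  fix X :: "nat \<Rightarrow> 'a set"
  assume X: "\<forall>n. ideal_of UNIV (X n)" "incseq X"
  have "stationary (\<lambda>n. X n \<inter> barideal \<omega>)"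
    using X by (auto intro!: noetherian_image[OF assms ideal_of_Int_barideal mono_Int_barideal])
  then show "stationary X" using X by (auto intro!: stationary_if_Int_barideal_stationary[of X])
qed

lemma artinian_if_barideal_artinian:
  assumes "artinian (barideal \<omega>)"
  shows "artinian UNIV"
  unfolding artinian_iff_stationary
proof (intro allI impI, elim conjE)
  fix X :: "nat \<Rightarrow> 'a set"
  assume X: "\<forall>n. ideal_of UNIV (X n)" "decseq X"
  have "stationary (\<lambda>n. X n \<inter> barideal \<omega>)"
    using X by (auto intro!: artinian_image[OF assms ideal_of_Int_barideal mono_Int_barideal])
  then show "stationary X" using X by (auto intro!: stationary_if_Int_barideal_stationary[of X])
qed

end

section \<open>The Peirce decomposition of a Bernstein algebra\<close>

text \<open>The square of any element of weight one is idempotent.\<close>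

lemma (in bernstein_algebra) weight_one_idempotent_exists:
  obtains e where "e \<cdot> e = e" and "\<omega> e = 1"
proof -
  obtain y where y: "\<omega> y \<noteq> 0" using weight_nonzero by blast
  define x where "x = inverse (\<omega> y) *s y"
  have x: "\<omega> x = 1" using y by (simp add: x_def weight_simps)
  show ?thesis
  proof (rule that)
    show "(x \<cdot> x) \<cdot> (x \<cdot> x) = x \<cdot> x" using bernstein[of x] x by simp
    show "\<omega> (x \<cdot> x) = 1" using x by (simp add: weight_mult)
  qed
qed

locale pointed_bernstein_algebra = bernstein_algebra scale mult \<omega>
  for scale :: "'k::field \<Rightarrow> 'a::ab_group_add \<Rightarrow> 'a" (infixr "*s" 75)
    and mult :: "'a \<Rightarrow> 'a \<Rightarrow> 'a" (infixl "\<cdot>" 70)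
    and \<omega> :: "'a \<Rightarrow> 'k" +
  fixes e :: 'a
  assumes idempotent: "e \<cdot> e = e" and weight_idempotent: "\<omega> e = 1"
    and two_neq_0: "(2::'k) \<noteq> 0" and three_neq_0: "(3::'k) \<noteq> 0"
begin

abbreviation N :: "'a set" where "N \<equiv> barideal \<omega>"

lemma scale_two_eq_0_iff: "2 *s x = 0 \<longleftrightarrow> x = 0"
  using two_neq_0 by simp

lemma add_self_eq_0_iff: "x + x = 0 \<longleftrightarrow> x = 0"
  for x :: 'a
  using scale_two_eq_0_iff[of x] by (simp add: scale_two)

text \<open>The left-hand side is the difference of the two sides of the Bernstein identity at
  \<open>e + t n\<close>, sorted by powers of \<open>t\<close>. The coefficient of \<open>t\<^sup>4\<close>, namely \<open>(nn)(nn)\<close>, vanishes by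
  the identity at \<open>n\<close>.\<close>

lemma bernstein_expansion:
  assumes n: "n \<in> N"
  shows "t *s (2 *s (2 *s (e \<cdot> (e \<cdot> n)) - e \<cdot> n))
     + (t * t) *s (2 *s (e \<cdot> (n \<cdot> n)) + 2 *s (2 *s ((e \<cdot> n) \<cdot> (e \<cdot> n))) - n \<cdot> n)
     + (t * t * t) *s (2 *s (2 *s ((e \<cdot> n) \<cdot> (n \<cdot> n)))) = 0"
proof -
  define a where "a = e \<cdot> n"
  define b where "b = n \<cdot> n"
  have ba: "b \<cdot> b = 0" using bernstein[of n] n by (simp add: b_def barideal_def)
  have comm: "n \<cdot> e = a" "a \<cdot> e = e \<cdot> a" "b \<cdot> e = e \<cdot> b" "b \<cdot> a = a \<cdot> b"
    by (simp_all add: a_def mult_commute)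
  let ?x = "e + t *s n"
  have w: "\<omega> ?x = 1" using n by (simp add: weight_simps weight_idempotent barideal_def)
  have sq: "?x \<cdot> ?x = e + t *s (a + a) + (t * t) *s b"
    by (simp add: bilinear_simps idempotent comm a_def[symmetric] b_def[symmetric]
        scale_right_distrib add_ac)
  have "(?x \<cdot> ?x) \<cdot> (?x \<cdot> ?x) = ?x \<cdot> ?x" using bernstein[of ?x] w by simp
  then show ?thesis
    unfolding sq a_def[symmetric] b_def[symmetric]
    by (simp add: bilinear_simps idempotent comm ba scale_two scale_right_distrib
        scale_right_diff_distrib algebra_simps)
qed

text \<open>A cubic polynomial in \<open>t\<close> without constant term that vanishes at \<open>1\<close>, \<open>-1\<close> and \<open>2\<close> has zero
  coefficients when \<open>2\<close> and \<open>3\<close> are invertible: the values at \<open>1\<close> and \<open>-1\<close> isolate the even part,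
  and the value at \<open>2\<close> then separates the odd coefficients, as \<open>8 - 2 = 2 \<cdot> 3\<close>.\<close>

lemma
  assumes n: "n \<in> N"
  shows Peirce_polynomial: "2 *s (e \<cdot> (e \<cdot> n)) = e \<cdot> n"
    and square_identity: "2 *s (e \<cdot> (n \<cdot> n)) + 2 *s (2 *s ((e \<cdot> n) \<cdot> (e \<cdot> n))) = n \<cdot> n"
    and cube_identity: "(e \<cdot> n) \<cdot> (n \<cdot> n) = 0"
proof -
  define p where "p = 2 *s (2 *s (e \<cdot> (e \<cdot> n)) - e \<cdot> n)"
  define q where "q = 2 *s (e \<cdot> (n \<cdot> n)) + 2 *s (2 *s ((e \<cdot> n) \<cdot> (e \<cdot> n))) - n \<cdot> n"
  define r where "r = 2 *s (2 *s ((e \<cdot> n) \<cdot> (n \<cdot> n)))"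
  have eq: "t *s p + (t * t) *s q + (t * t * t) *s r = 0" for t
    using bernstein_expansion[OF n, of t] by (simp add: p_def q_def r_def)
  have pqr: "p + q + r = 0" using eq[of 1] by simp
  have "q + q = (p + q + r) + (- p + q - r)" by (simp add: algebra_simps)
  also have "\<dots> = 0" using pqr eq[of "- 1"] by simp
  finally have "q + q = 0" .
  then have q: "q = 0" by (simp add: add_self_eq_0_iff)
  with pqr have p: "p = - r" by (simp add: eq_neg_iff_add_eq_0)
  have "2 *s p + 8 *s r = 0" using eq[of 2] q by simp
  then have "(8 - 2) *s r = 0" unfolding p by (simp only: scale_left_diff_distrib) simp
  moreover have "(8 - 2 :: 'k) = 2 * 3" by simp
  then have "(8 - 2 :: 'k) \<noteq> 0" using two_neq_0 three_neq_0 by (metis mult_eq_0_iff)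
  ultimately have r: "r = 0" by (metis scale_eq_0_iff)
  show "2 *s (e \<cdot> (e \<cdot> n)) = e \<cdot> n" using p r by (simp add: p_def two_neq_0)
  show "2 *s (e \<cdot> (n \<cdot> n)) + 2 *s (2 *s ((e \<cdot> n) \<cdot> (e \<cdot> n))) = n \<cdot> n" using q by (simp add: q_def)
  show "(e \<cdot> n) \<cdot> (n \<cdot> n) = 0" using r unfolding r_def scale_two_eq_0_iff .
qed

text \<open>This polarisation contains the whole multiplication table of the Peirce components: on \<open>U\<close> the
  second term is \<open>xy\<close>, and if one factor lies in \<open>V\<close> it vanishes.\<close>

lemma product_identity:
  assumes x: "x \<in> N" and y: "y \<in> N"
  shows "2 *s (e \<cdot> (x \<cdot> y)) + 2 *s (2 *s ((e \<cdot> x) \<cdot> (e \<cdot> y))) = x \<cdot> y"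
proof -
  have xy: "x + y \<in> N" using x y subspace_barideal by (rule subspace_add[rotated])
  let ?d = "\<lambda>z w. 2 *s (e \<cdot> (z \<cdot> w)) + 2 *s (2 *s ((e \<cdot> z) \<cdot> (e \<cdot> w))) - z \<cdot> w"
  have "?d (x + y) (x + y) - ?d x x - ?d y y = ?d x y + ?d x y"
    by (simp add: bilinear_simps scale_right_distrib mult_commute[of y x]
        mult_commute[of "e \<cdot> y" "e \<cdot> x"] algebra_simps)
  then have "?d x y + ?d x y = 0"
    using square_identity[OF x] square_identity[OF y] square_identity[OF xy] by simp
  then show ?thesis by (simp add: add_self_eq_0_iff)
qed

definition U :: "'a set" where "U = {x. 2 *s (e \<cdot> x) = x}"

definition V :: "'a set" where "V = {x. e \<cdot> x = 0}"

lemma idempotent_mult_U: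
  assumes "u \<in> U"
  shows "e \<cdot> u = inverse 2 *s u"
proof -
  have "inverse 2 *s u = inverse 2 *s (2 *s (e \<cdot> u))" using assms by (simp add: U_def)
  then show ?thesis using two_neq_0 by simp
qed

lemma subspace_U: "subspace U"
  by (auto simp: U_def subspace_def bilinear_simps scale_right_distrib scale_left_commute[of 2]
      simp del: scale_scale)

lemma subspace_V: "subspace V"
  by (auto simp: V_def subspace_def bilinear_simps)

lemma U_subset_N: "U \<subseteq> N"
proof
  fix x assume "x \<in> U"
  then have "\<omega> (2 *s (e \<cdot> x)) = \<omega> x" by (simp add: U_def)
  then have "\<omega> x + \<omega> x = \<omega> x + 0" by (simp add: weight_simps weight_idempotent)
  then have "\<omega> x = 0" by (rule add_left_imp_eq)
  then show "x \<in> N" by (simp add: barideal_def)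
qed

lemma V_subset_N: "V \<subseteq> N"
proof
  fix x assume "x \<in> V"
  then have "\<omega> (e \<cdot> x) = 0" by (simp add: V_def weight_zero)
  then show "x \<in> N" by (simp add: weight_mult weight_idempotent barideal_def)
qed

lemma Peirce_decomposition:
  assumes "x \<in> N"
  obtains u v where "u \<in> U" "v \<in> V" "x = u + v"
proof
  show "2 *s (e \<cdot> x) \<in> U" "x - 2 *s (e \<cdot> x) \<in> V"
    using Peirce_polynomial[OF assms] by (simp_all add: U_def V_def bilinear_simps)
qed simp

lemma U_Int_V: "x \<in> U \<Longrightarrow> x \<in> V \<Longrightarrow> x = 0"
  by (simp add: U_def V_def)

lemma Peirce_unique:
  assumes "u \<in> U" "v \<in> V" "u' \<in> U" "v' \<in> V" and eq: "u + v = u' + v'"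
  shows "u = u'" and "v = v'"
proof -
  have "u - u' = v' - v" using eq by (simp add: algebra_simps)
  moreover have "u - u' \<in> U" "v' - v \<in> V"
    using assms by (auto intro: subspace_diff subspace_U subspace_V)
  ultimately show "u = u'" using U_Int_V[of "u - u'"] by simp
  then show "v = v'" using eq by simp
qed

lemma mult_UU: "u \<in> U \<Longrightarrow> u' \<in> U \<Longrightarrow> u \<cdot> u' \<in> V"
proof -
  assume u: "u \<in> U" "u' \<in> U"
  then have N: "u \<in> N" "u' \<in> N" using U_subset_N by auto
  have "2 *s (2 *s ((e \<cdot> u) \<cdot> (e \<cdot> u'))) = (2 *s (e \<cdot> u)) \<cdot> (2 *s (e \<cdot> u'))"
    by (simp only: bilinear_simps)
  also have "\<dots> = u \<cdot> u'" using u by (simp add: U_def)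
  finally have "2 *s (e \<cdot> (u \<cdot> u')) = 0" using product_identity[OF N] by simp
  then show ?thesis by (simp add: V_def two_neq_0)
qed

lemma mult_NV: "x \<in> N \<Longrightarrow> v \<in> V \<Longrightarrow> x \<cdot> v \<in> U"
  using product_identity[of x v] V_subset_N by (auto simp: U_def V_def bilinear_simps)

lemma mult_UV: "u \<in> U \<Longrightarrow> v \<in> V \<Longrightarrow> u \<cdot> v \<in> U"
  using mult_NV U_subset_N by auto

text \<open>The cubic identity at \<open>u \<plusminus> v\<close> reads \<open>u(uu \<plusminus> 2uv + vv) = 0\<close>; the difference of the two is
  \<open>4u(uv) = 0\<close>.\<close>

lemma mult_self_UV:
  assumes u: "u \<in> U" and v: "v \<in> V"
  shows "u \<cdot> (u \<cdot> v) = 0"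
proof -
  have cube: "u \<cdot> ((u + w) \<cdot> (u + w)) = 0" if w: "w \<in> V" for w
  proof -
    have "u + w \<in> N" using u w U_subset_N V_subset_N subspace_barideal by (auto intro: subspace_add)
    from cube_identity[OF this] have "(2 *s (e \<cdot> (u + w))) \<cdot> ((u + w) \<cdot> (u + w)) = 0"
      by (simp only: mult_scale_left) simp
    moreover have "2 *s (e \<cdot> (u + w)) = u" using u w by (simp add: U_def V_def bilinear_simps)
    ultimately show ?thesis by simp
  qed
  let ?z = "u \<cdot> (u \<cdot> v)"
  have "u \<cdot> ((u + v) \<cdot> (u + v)) - u \<cdot> ((u + - v) \<cdot> (u + - v)) = (?z + ?z) + (?z + ?z)"
    by (simp only: bilinear_simps mult_commute[of v u]) (simp add: algebra_simps)
  then have "(?z + ?z) + (?z + ?z) = 0"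
    using cube[OF v] cube[of "- v"] subspace_neg[OF subspace_V v] by simp
  then show ?thesis by (simp only: add_self_eq_0_iff)
qed

text \<open>The polarisation of the preceding identity. It is what makes the envelope below stable under
  multiplication by \<open>V\<close>.\<close>

lemma mult_UV_skew:
  assumes u: "u \<in> U" and u': "u' \<in> U" and v: "v \<in> V"
  shows "u' \<cdot> (u \<cdot> v) = - (u \<cdot> (u' \<cdot> v))"
proof -
  have "(u + u') \<cdot> ((u + u') \<cdot> v) = 0"
    using mult_self_UV subspace_add[OF subspace_U u u'] v by blast
  then show ?thesis
    using mult_self_UV[OF u v] mult_self_UV[OF u' v]
    by (simp add: bilinear_simps eq_neg_iff_add_eq_0 add.commute)
qed

section \<open>The two ideals of the algebra attached to an ideal of the barideal\<close>

text \<open>Since \<open>A = K e \<oplus> N\<close>, only the products with \<open>e\<close> and with \<open>N\<close> have to be checked.\<close>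

lemma ideal_ofI:
  assumes sub: "subspace I" and IN: "I \<subseteq> N"
    and e: "\<And>x. x \<in> I \<Longrightarrow> e \<cdot> x \<in> I" and N: "\<And>y x. y \<in> N \<Longrightarrow> x \<in> I \<Longrightarrow> y \<cdot> x \<in> I"
  shows "ideal_of UNIV I"
proof -
  have "y \<cdot> x \<in> I" if x: "x \<in> I" for x y
  proof -
    have "y - \<omega> y *s e \<in> N" by (simp add: barideal_def weight_simps weight_idempotent)
    then have "(y - \<omega> y *s e) \<cdot> x + \<omega> y *s (e \<cdot> x) \<in> I"
      using x sub by (intro subspace_add subspace_scale e N)
    then show ?thesis by (simp add: bilinear_simps)
  qed
  then have "\<forall>y. \<forall>x\<in>I. y \<cdot> x \<in> I \<and> x \<cdot> y \<in> I" by (metis mult_commute)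
  then show ?thesis using sub by (simp add: ideal_of_def)
qed

text \<open>For \<open>x = u + v\<close> with \<open>u \<in> U\<close> and \<open>v \<in> V\<close> one has \<open>ex = u/2\<close>, so for an ideal \<open>I\<close> of \<open>N\<close> this
  is \<open>(I \<inter> U) \<oplus> (I \<inter> V)\<close>, the largest ideal of \<open>A\<close> contained in \<open>I\<close>.\<close>

definition core :: "'a set \<Rightarrow> 'a set" where
  "core I = {x \<in> I. e \<cdot> x \<in> I}"

lemma mono_core: "mono core"
  by (auto simp: monotone_def core_def)

text \<open>The point is that \<open>e(yx) \<in> I\<close> for \<open>y \<in> N\<close>: by the product identity \<open>2e(yx)\<close> is
  \<open>yx - 4(ey)(ex)\<close>, and both \<open>x\<close> and \<open>ex\<close> lie in the ideal \<open>I\<close> of \<open>N\<close>.\<close>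

lemma ideal_of_core:
  assumes I: "ideal_of N I"
  shows "ideal_of UNIV (core I)"
proof (rule ideal_ofI)
  note sub = ideal_of_subspace[OF I]
  have IN: "I \<subseteq> N" using I by (simp add: ideal_of_def)
  have IM: "y \<cdot> x \<in> I" if "y \<in> N" "x \<in> I" for x y using I that by (simp add: ideal_of_def)
  show "subspace (core I)"
    using sub by (auto simp: subspace_def core_def bilinear_simps)
  show "core I \<subseteq> N" using IN by (auto simp: core_def)
  have half: "z \<in> I" if "2 *s z \<in> I" for z
    using subspace_scale[OF sub that, of "inverse 2"] two_neq_0 by simp
  show "e \<cdot> x \<in> core I" if x: "x \<in> core I" for x
    using x IN half[of "e \<cdot> (e \<cdot> x)"] Peirce_polynomial[of x] by (auto simp: core_def)
  show "y \<cdot> x \<in> core I" if y: "y \<in> N" and x: "x \<in> core I" for x y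
  proof -
    have ey: "e \<cdot> y \<in> N" using y ideal_of_barideal by (simp add: ideal_of_def)
    have "2 *s (e \<cdot> (y \<cdot> x)) = y \<cdot> x - 2 *s (2 *s ((e \<cdot> y) \<cdot> (e \<cdot> x)))"
      using product_identity[of y x] x y IN by (auto simp: core_def algebra_simps)
    also have "\<dots> \<in> I"
      using IM[OF y, of x] IM[OF ey, of "e \<cdot> x"] x
      by (intro subspace_diff subspace_scale sub) (auto simp: core_def)
    finally show ?thesis using half IM[OF y] x by (auto simp: core_def)
  qed
qed

definition V_projection :: "'a set \<Rightarrow> 'a set" where
  "V_projection I = {v \<in> V. \<exists>u\<in>U. u + v \<in> I}"

text \<open>The smallest ideal of \<open>A\<close> containing \<open>I\<close> has an awkward \<open>U\<close>-component, generated by repeated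
  multiplication with \<open>V\<close>. Taking instead the largest \<open>U\<close>-component compatible with the
  \<open>V\<close>-component \<open>V_projection I\<close> gives an ideal described in closed form.\<close>

definition envelope :: "'a set \<Rightarrow> 'a set" where
  "envelope I = {u + v |u v. u \<in> U \<and> (\<forall>u'\<in>U. u' \<cdot> u \<in> V_projection I) \<and> v \<in> V_projection I}"

lemma V_projection_mono: "I \<subseteq> J \<Longrightarrow> V_projection I \<subseteq> V_projection J"
  by (auto simp: V_projection_def)

lemma mono_envelope: "mono envelope"
proof (rule monoI)
  fix I J :: "'a set" assume "I \<subseteq> J"
  from V_projection_mono[OF this] show "envelope I \<subseteq> envelope J"
    unfolding envelope_def by blast
qed

lemma subspace_V_projection:
  assumes I: "subspace I"
  shows "subspace (V_projection I)"
  unfolding subspace_def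
proof (intro conjI ballI allI)
  show "0 \<in> V_projection I"
    using subspace_0[OF subspace_U] subspace_0[OF subspace_V] subspace_0[OF I]
    unfolding V_projection_def by (metis (mono_tags, lifting) add.right_neutral mem_Collect_eq)
  fix v assume "v \<in> V_projection I"
  then obtain u where u: "u \<in> U" "v \<in> V" "u + v \<in> I" by (auto simp: V_projection_def)
  show "c *s v \<in> V_projection I" for c
    using u subspace_scale[OF subspace_U u(1), of c] subspace_scale[OF subspace_V u(2), of c]
      subspace_scale[OF I u(3), of c]
    by (auto simp: V_projection_def scale_right_distrib)
  fix v' assume "v' \<in> V_projection I"
  then obtain u' where u': "u' \<in> U" "v' \<in> V" "u' + v' \<in> I" by (auto simp: V_projection_def)
  have "(u + u') + (v + v') \<in> I"
    using subspace_add[OF I u(3) u'(3)] by (simp add: algebra_simps)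
  then show "v + v' \<in> V_projection I"
    using u u' subspace_add[OF subspace_U u(1) u'(1)] subspace_add[OF subspace_V u(2) u'(2)]
    by (auto simp: V_projection_def)
qed

lemma V_projectionI: "u \<in> U \<Longrightarrow> v \<in> V \<Longrightarrow> u + v \<in> I \<Longrightarrow> v \<in> V_projection I"
  by (auto simp: V_projection_def)

text \<open>Write the envelope as \<open>T \<oplus> P\<close>. Then \<open>UT \<subseteq> P\<close> by definition of \<open>T\<close>, and \<open>VT \<subseteq> T\<close> because
  \<open>u'(uv) = -u(u'v) \<in> P\<close> for \<open>u \<in> T\<close>. For \<open>x = u + v \<in> I\<close> with \<open>u \<in> U\<close> and \<open>v \<in> V\<close>, the
  components of \<open>u'x = u'v + u'u\<close> show that \<open>U\<close> maps the \<open>U\<close>-component of \<open>I\<close> into \<open>P\<close>; hence that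
  component lies in \<open>T\<close>, and \<open>u'v\<close>, as the \<open>U\<close>-component of \<open>u'x \<in> I\<close>, lies in \<open>T\<close> as well, so
  \<open>UP \<subseteq> T\<close>. Finally \<open>VP \<subseteq> T\<close>, as \<open>v'v\<close> is the difference of \<open>v'x \<in> I \<inter> U \<subseteq> T\<close> and
  \<open>v'u \<in> VT \<subseteq> T\<close>.\<close>

lemma ideal_of_envelope:
  assumes I: "ideal_of N I"
  shows "ideal_of UNIV (envelope I)"
proof (rule ideal_ofI)
  note sub = ideal_of_subspace[OF I]
  have IM: "y \<cdot> x \<in> I" if "y \<in> N" "x \<in> I" for x y using I that by (simp add: ideal_of_def)
  define P where "P = V_projection I"
  define T where "T = {u \<in> U. \<forall>u'\<in>U. u' \<cdot> u \<in> P}"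
  have envelope: "envelope I = {u + v |u v. u \<in> T \<and> v \<in> P}"
    by (auto simp: envelope_def T_def P_def)
  have subP: "subspace P" unfolding P_def by (rule subspace_V_projection[OF sub])
  have subT: "subspace T"
    using subspace_U subP by (simp add: T_def subspace_def bilinear_simps)
  have PV: "P \<subseteq> V" and TU: "T \<subseteq> U" by (auto simp: P_def V_projection_def T_def)
  have sums: "u + v \<in> envelope I" if "u \<in> T" "v \<in> P" for u v using that envelope by auto
  show "subspace (envelope I)"
    unfolding envelope by (rule subspace_sums[OF subT subP])
  show "envelope I \<subseteq> N"
  proof
    fix x assume "x \<in> envelope I"
    then obtain u v where uv: "u \<in> T" "v \<in> P" "x = u + v" using envelope by blast
    then have "u \<in> N" "v \<in> N" using PV TU U_subset_N V_subset_N by auto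
    then show "x \<in> N" unfolding uv(3) by (rule subspace_add[OF subspace_barideal])
  qed
  have UT: "u' \<cdot> u \<in> P" if "u' \<in> U" "u \<in> T" for u u' using that by (auto simp: T_def)
  have VT: "v \<cdot> u \<in> T" if v: "v \<in> V" and u: "u \<in> T" for u v
  proof -
    have uU: "u \<in> U" using u TU by blast
    have "u' \<cdot> (u \<cdot> v) \<in> P" if u': "u' \<in> U" for u'
      using mult_UV_skew[OF uU u' v] UT[OF mult_UV[OF u' v] u] subspace_neg[OF subP]
      by (simp add: mult_commute)
    then show ?thesis using mult_UV[OF uU v] by (simp add: T_def mult_commute)
  qed
  have UT_component: "u \<in> T" if u: "u \<in> U" and v: "v \<in> V" and uv: "u + v \<in> I" for u v
  proof -
    have "u' \<cdot> u \<in> P" if u': "u' \<in> U" for u'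
    proof -
      have "u' \<cdot> v + u' \<cdot> u \<in> I"
        using IM[OF _ uv, of u'] u' U_subset_N by (auto simp: bilinear_simps add.commute)
      then show ?thesis
        unfolding P_def by (rule V_projectionI[OF mult_UV[OF u' v] mult_UU[OF u' u]])
    qed
    then show ?thesis using u by (simp add: T_def)
  qed
  have I_U: "u \<in> T" if "u \<in> U" "u \<in> I" for u
    using UT_component[of u 0] that subspace_0[OF subspace_V] by simp
  (* The two alternatives for y are treated separately, since y x = y u + y v splits into Peirce
     components for y in U but lies entirely in U for y in V. *)
  have NP: "y \<cdot> v \<in> T" if y: "y \<in> U \<or> y \<in> V" and v: "v \<in> P" for y v
  proof -
    obtain u where u: "u \<in> U" "v \<in> V" "u + v \<in> I"
      using v by (auto simp: P_def V_projection_def)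
    have yN: "y \<in> N" using y U_subset_N V_subset_N by blast
    have yx: "y \<cdot> u + y \<cdot> v \<in> I" using IM[OF yN u(3)] by (simp add: bilinear_simps)
    have yv: "y \<cdot> v \<in> U" using mult_NV[OF yN u(2)] .
    show ?thesis
    proof (cases "y \<in> U")
      case True
      then show ?thesis
        using UT_component[OF yv mult_UU[OF True u(1)]] yx by (simp add: add.commute)
    next
      case False
      then have yV: "y \<in> V" using y by blast
      have yu: "y \<cdot> u \<in> T" using VT[OF yV UT_component[OF u]] .
      have "y \<cdot> u + y \<cdot> v \<in> T"
        using I_U[OF _ yx] subspace_add[OF subspace_U _ yv] yu TU by blast
      from subspace_diff[OF subT this yu] show ?thesis by simp
    qed
  qed
  show "e \<cdot> x \<in> envelope I" if x: "x \<in> envelope I" for x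
  proof -
    obtain u v where uv: "u \<in> T" "v \<in> P" "x = u + v" using x envelope by blast
    have "e \<cdot> v = 0" using uv PV by (auto simp: V_def)
    moreover have "e \<cdot> u = inverse 2 *s u" using uv TU by (intro idempotent_mult_U) auto
    ultimately have "e \<cdot> x = inverse 2 *s u + 0" by (simp add: uv bilinear_simps)
    also have "\<dots> \<in> envelope I" by (intro sums subspace_scale subT subP subspace_0 uv)
    finally show ?thesis .
  qed
  show "y \<cdot> x \<in> envelope I" if y: "y \<in> N" and x: "x \<in> envelope I" for x y
  proof -
    obtain u v where uv: "u \<in> T" "v \<in> P" "x = u + v" using x envelope by blast
    obtain a b where ab: "a \<in> U" "b \<in> V" "y = a + b" using Peirce_decomposition[OF y] .
    have "(a \<cdot> v + b \<cdot> v + b \<cdot> u) + a \<cdot> u \<in> envelope I"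
      using uv ab by (intro sums subspace_add subT UT VT NP) auto
    then show ?thesis by (simp add: uv ab bilinear_simps algebra_simps)
  qed
qed

text \<open>Given \<open>x = u + v \<in> J\<close>, equality of the envelopes yields some \<open>u' + v \<in> I\<close> with \<open>u' \<in> U\<close>. The
  difference \<open>u - u'\<close> lies in \<open>J \<inter> U\<close>, hence in the core of \<open>J\<close>, which is the core of \<open>I\<close>.\<close>

lemma ideal_eqI_core_envelope:
  assumes I: "ideal_of N I" and J: "ideal_of N J" and IJ: "I \<subseteq> J"
    and core: "core I = core J" and envelope: "envelope I = envelope J"
  shows "I = J"
proof -
  note subI = ideal_of_subspace[OF I] and subJ = ideal_of_subspace[OF J]
  have "x \<in> I" if x: "x \<in> J" for x
  proof -
    have "x \<in> N" using J x by (auto simp: ideal_of_def)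
    then obtain u v where uv: "u \<in> U" "v \<in> V" "x = u + v" by (rule Peirce_decomposition)
    have "v \<in> V_projection J" using uv x by (auto intro: V_projectionI)
    moreover have "0 \<in> U" "\<forall>u'\<in>U. u' \<cdot> 0 \<in> V_projection J"
      using subspace_0[OF subspace_U] subspace_0[OF subspace_V_projection[OF subJ]]
      by (simp_all add: bilinear_simps)
    ultimately have "0 + v \<in> envelope J" unfolding envelope_def by blast
    then have "0 + v \<in> envelope I" unfolding envelope .
    then obtain u1 v1 where u1: "u1 \<in> U" "v1 \<in> V_projection I" "0 + v = u1 + v1"
      unfolding envelope_def by blast
    then have "v = v1"
      using Peirce_unique(2)[of 0 v u1 v1] uv subspace_0[OF subspace_U] by (auto simp: V_projection_def)
    then obtain u' where u': "u' \<in> U" "u' + v \<in> I" using u1 by (auto simp: V_projection_def)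
    have d: "u - u' \<in> U" using uv u' by (auto intro: subspace_diff subspace_U)
    have "x - (u' + v) \<in> J" using u' IJ by (intro subspace_diff[OF subJ x]) auto
    then have dJ: "u - u' \<in> J" by (simp add: uv)
    have "e \<cdot> (u - u') = inverse 2 *s (u - u')"
      using d by (rule idempotent_mult_U)
    then have "u - u' \<in> core J" using dJ subspace_scale[OF subJ dJ] by (simp add: core_def)
    then have "u - u' \<in> I" using core by (auto simp: core_def)
    from subspace_add[OF subI this u'(2)] show ?thesis by (simp add: uv)
  qed
  with IJ show ?thesis by blast
qed

lemma stationary_if_core_envelope_stationary:
  assumes "\<And>n. ideal_of N (X n)" and "incseq X \<or> decseq X"
    and "stationary (\<lambda>n. core (X n))" and "stationary (\<lambda>n. envelope (X n))"
  shows "stationary X"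
  using assms(2-4)
  by (rule stationary_if_invariants_stationary) (rule ideal_eqI_core_envelope[OF assms(1) assms(1)])

lemma barideal_noetherian_if_noetherian:
  assumes "noetherian UNIV"
  shows "noetherian N"
  unfolding noetherian_iff_stationary
  using noetherian_image[OF assms ideal_of_core mono_core]
    noetherian_image[OF assms ideal_of_envelope mono_envelope]
  by (auto intro: stationary_if_core_envelope_stationary)

lemma barideal_artinian_if_artinian:
  assumes "artinian UNIV"
  shows "artinian N"
  unfolding artinian_iff_stationary
  using artinian_image[OF assms ideal_of_core mono_core]
    artinian_image[OF assms ideal_of_envelope mono_envelope]
  by (auto intro: stationary_if_core_envelope_stationary)

end

lemma of_nat_prime_neq_0:
  assumes "CHAR('k::field) \<noteq> p" and "prime p"
  shows "(of_nat p :: 'k) \<noteq> 0"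
  using assms CHAR_not_1 unfolding of_nat_eq_0_iff_char_dvd prime_nat_iff
  by (metis One_nat_def)

theorem theorem3p1:
  fixes scale :: "'k::field \<Rightarrow> 'a::ab_group_add \<Rightarrow> 'a"
    and mult :: "'a \<Rightarrow> 'a \<Rightarrow> 'a"
    and \<omega> :: "'a \<Rightarrow> 'k"
  assumes "infinite (UNIV :: 'k set)"
    and "CHAR('k) \<noteq> 2" and "CHAR('k) \<noteq> 3"
    and "bernstein_algebra scale mult \<omega>"
  shows "(nonassoc_algebra.noetherian scale mult UNIV
            \<longleftrightarrow> nonassoc_algebra.noetherian scale mult (barideal \<omega>))
       \<and> (nonassoc_algebra.artinian scale mult UNIV
            \<longleftrightarrow> nonassoc_algebra.artinian scale mult (barideal \<omega>))"
proof -
  interpret bernstein_algebra scale mult \<omega> by fact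
  obtain e where e: "mult e e = e" "\<omega> e = 1" by (rule weight_one_idempotent_exists)
  interpret pointed_bernstein_algebra scale mult \<omega> e
    by unfold_locales
      (use e of_nat_prime_neq_0[OF assms(2)] of_nat_prime_neq_0[OF assms(3)] in simp_all)
  show ?thesis
    using noetherian_if_barideal_noetherian artinian_if_barideal_artinian
      barideal_noetherian_if_noetherian barideal_artinian_if_artinian by blast
qed

end
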